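(* Let $i\in\{0,1\}$ and let $A$ be an $i$-diagonal incidence matrix of a symmetric $(v,k,\lambda)$ design. Then the array $B$ with entries in $\{0,1\}$ defined by $$B(x,y,z)=A(x,y)+A(y,z)+A(x,z)\ \bmod 2,\qquad x,y,z\in\{1,\dots,v\},$$ is a $\mathcal{C}^3_3(v,K_i,\Lambda_i)$-cube, where $$K_0=k(3v+4\lambda-6k),\qquad \Lambda_0=k(v-4\lambda-2)+2\lambda(2\lambda+1),$$ $$K_1=k(3v+4\lambda-2k)-4v\lambda,\qquad \Lambda_1=k(v-4\lambda+2)+2\lambda(2\lambda-1).$$
   Context: An incidence matrix of a symmetric $(v,k,\lambda)$ design is a $v\times v$ matrix over $\{0,1\}$ with exactly $k$ ones in every row and column, such that the scalar product of any two distinct rows, and of any two distinct columns, is $\lambda$. A matrix is $i$-diagonal if all its diagonal entries are equal to $i$. A $v\times v\times v$ array is a function on $\{1,\dots,v\}^3$. A layer is obtained by fixing one of the three coordinates; two layers are parallel if they fix the same coordinate, to different values; their scalar product is the sum over all positions of the product of corresponding entries. A $\mathcal{C}^3_3(v,K,\Lambda)$-cube is a $v\times v\times v$ array over $\{0,1\}$ such that every layer (in each of the three directions) contains exactly $K$ ones and every two parallel layers have scalar product $\Lambda$. *)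

theory Defs
  imports Main
begin

text \<open>Matrices of order \<open>v\<close> and \<open>v \<times> v \<times> v\<close> arrays are functions on \<open>nat\<close>, of which only the
  values at arguments in \<open>{1..v}\<close> are ever inspected. The entries are of type \<open>nat\<close>.\<close>

definition sym_design_incidence :: "nat \<Rightarrow> nat \<Rightarrow> nat \<Rightarrow> (nat \<Rightarrow> nat \<Rightarrow> nat) \<Rightarrow> bool" where
  "sym_design_incidence v k l A \<longleftrightarrow>
     (\<forall>x\<in>{1..v}. \<forall>y\<in>{1..v}. A x y \<in> {0, 1}) \<and>
     (\<forall>x\<in>{1..v}. card {y\<in>{1..v}. A x y = 1} = k) \<and>
     (\<forall>y\<in>{1..v}. card {x\<in>{1..v}. A x y = 1} = k) \<and>
     (\<forall>x\<in>{1..v}. \<forall>x'\<in>{1..v}. x \<noteq> x' \<longrightarrow> (\<Sum>y\<in>{1..v}. A x y * A x' y) = l) \<and>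
     (\<forall>y\<in>{1..v}. \<forall>y'\<in>{1..v}. y \<noteq> y' \<longrightarrow> (\<Sum>x\<in>{1..v}. A x y * A x y') = l)"

definition diagonal_const :: "nat \<Rightarrow> nat \<Rightarrow> (nat \<Rightarrow> nat \<Rightarrow> nat) \<Rightarrow> bool" where
  "diagonal_const v i A \<longleftrightarrow> (\<forall>x\<in>{1..v}. A x x = i)"

datatype direction = Dir1 | Dir2 | Dir3

text \<open>\<open>layer d c B\<close> fixes the coordinate in direction \<open>d\<close> to the value \<open>c\<close>; the other two
  coordinates keep their order.\<close>

fun layer :: "direction \<Rightarrow> nat \<Rightarrow> (nat \<Rightarrow> nat \<Rightarrow> nat \<Rightarrow> nat) \<Rightarrow> nat \<Rightarrow> nat \<Rightarrow> nat" where
  "layer Dir1 c B p q = B c p q"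
| "layer Dir2 c B p q = B p c q"
| "layer Dir3 c B p q = B p q c"

text \<open>The parameters \<open>K\<close> and \<open>L\<close> are integers, so that the polynomial expressions supplied for
  them can be evaluated without truncated subtraction.\<close>

definition C33_cube :: "nat \<Rightarrow> int \<Rightarrow> int \<Rightarrow> (nat \<Rightarrow> nat \<Rightarrow> nat \<Rightarrow> nat) \<Rightarrow> bool" where
  "C33_cube v K L B \<longleftrightarrow>
     (\<forall>x\<in>{1..v}. \<forall>y\<in>{1..v}. \<forall>z\<in>{1..v}. B x y z \<in> {0, 1}) \<and>
     (\<forall>d. \<forall>c\<in>{1..v}. int (card {(p, q) \<in> {1..v} \<times> {1..v}. layer d c B p q = 1}) = K) \<and>
     (\<forall>d. \<forall>c\<in>{1..v}. \<forall>c'\<in>{1..v}. c \<noteq> c' \<longrightarrow>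
        int (\<Sum>p\<in>{1..v}. \<Sum>q\<in>{1..v}. layer d c B p q * layer d c' B p q) = L)"

definition K_param :: "nat \<Rightarrow> int \<Rightarrow> int \<Rightarrow> int \<Rightarrow> int" where
  "K_param i v k l =
     (if i = 0 then k * (3 * v + 4 * l - 6 * k)
      else k * (3 * v + 4 * l - 2 * k) - 4 * v * l)"

definition Lambda_param :: "nat \<Rightarrow> int \<Rightarrow> int \<Rightarrow> int \<Rightarrow> int" where
  "Lambda_param i v k l =
     (if i = 0 then k * (v - 4 * l - 2) + 2 * l * (2 * l + 1)
      else k * (v - 4 * l + 2) + 2 * l * (2 * l - 1))"

end

theory Submission
  imports Defs
begin

text \<open>Pass to signs: \<open>s = 1 - 2 A\<close> has entries \<open>\<plusminus>1\<close>, and the sum modulo 2 becomes the product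
  \<open>1 - 2 B(x,y,z) = s(x,y) s(y,z) s(x,z)\<close>. The rows (columns) of \<open>s\<close> have sum \<open>r = v - 2k\<close> and
  pairwise scalar product \<open>m = v - 4k + 4\<lambda>\<close>. Summing first over the coordinate occurring in
  two row (column) entries, a layer of signs has sum \<open>m r + (v - m) e\<close>, where \<open>e\<close> is the diagonal
  sign. In the product of two parallel layers the common factor squares to 1 and the remaining
  sum is \<open>m\<^sup>2\<close>. The parameters follow using \<open>k(k - 1) = \<lambda>(v - 1)\<close>.\<close>

text \<open>Scalar products of rows or columns take one value at equal indices and another
  elsewhere. This evaluates a weighted sum of such products: constant weight for the row-sum
  relation, a row or column of signs as weight for the layer sums.\<close>

lemma sum_mult_if_eq:
  fixes w :: "'a \<Rightarrow> int"
  assumes "finite I" "c \<in> I"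
  shows "(\<Sum>a\<in>I. w a * (if a = c then n else m)) = m * (\<Sum>a\<in>I. w a) + (n - m) * w c"
proof -
  have "(\<Sum>a\<in>I. w a * (if a = c then n else m))
      = (\<Sum>a\<in>I. m * w a + (if a = c then (n - m) * w a else 0))"
    by (rule sum.cong) (auto simp: algebra_simps)
  also have "\<dots> = m * (\<Sum>a\<in>I. w a) + (n - m) * w c"
    using assms by (simp add: sum.distrib sum_distrib_left)
  finally show ?thesis .
qed

lemma card_Collect_eq_1:
  fixes f :: "'a \<Rightarrow> nat"
  assumes "finite I" "\<And>x. x \<in> I \<Longrightarrow> f x \<in> {0, 1}"
  shows "card {x\<in>I. f x = 1} = (\<Sum>x\<in>I. f x)"
proof -
  have "(\<Sum>x\<in>I. f x) = (\<Sum>x\<in>I. if f x = 1 then 1 else 0)"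
    by (rule sum.cong) (use assms in auto)
  then show ?thesis
    using assms by (simp add: sum.If_cases Int_def)
qed

lemma sign_triple_mod_2:
  fixes a b c :: nat
  assumes "a \<in> {0, 1}" "b \<in> {0, 1}" "c \<in> {0, 1}"
  shows "1 - 2 * int ((a + b + c) mod 2) = (1 - 2 * int a) * (1 - 2 * int b) * (1 - 2 * int c)"
  using assms by (auto simp: mod_Suc)

text \<open>For bits \<open>b\<close>, \<open>b'\<close> the product of signs is
  \<open>1 - 2 b - 2 b' + 4 b b'\<close>. Sums of signs over a layer and over a product of layers
  are therefore affine in the number of ones and the scalar product, and determine both.\<close>

lemma C33_cube_signedI:
  fixes B :: "nat \<Rightarrow> nat \<Rightarrow> nat \<Rightarrow> nat"
  defines "T \<equiv> \<lambda>d c p q. 1 - 2 * int (layer d c B p q)"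
  assumes B01: "\<And>x y z. x \<in> {1..v} \<Longrightarrow> y \<in> {1..v} \<Longrightarrow> z \<in> {1..v} \<Longrightarrow> B x y z \<in> {0, 1}"
    and T: "\<And>d c. c \<in> {1..v} \<Longrightarrow> (\<Sum>p\<in>{1..v}. \<Sum>q\<in>{1..v}. T d c p q) = int v * int v - 2 * K"
    and TT: "\<And>d c c'. c \<in> {1..v} \<Longrightarrow> c' \<in> {1..v} \<Longrightarrow> c \<noteq> c' \<Longrightarrow>
      (\<Sum>p\<in>{1..v}. \<Sum>q\<in>{1..v}. T d c p q * T d c' p q) = int v * int v - 4 * K + 4 * L"
  shows "C33_cube v K L B"
proof -
  have layer01: "layer d c B p q \<in> {0, 1}"
    if "c \<in> {1..v}" "p \<in> {1..v}" "q \<in> {1..v}" for d c p q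
    using B01 that by (cases d) auto
  have K: "(\<Sum>p\<in>{1..v}. \<Sum>q\<in>{1..v}. int (layer d c B p q)) = K" if "c \<in> {1..v}" for d c
    using T[OF that, of d] by (simp add: T_def sum_subtractf sum_distrib_left [symmetric])
  have "int (card {(p, q) \<in> {1..v} \<times> {1..v}. layer d c B p q = 1}) = K"
    if c: "c \<in> {1..v}" for d c
  proof -
    have "{(p, q) \<in> {1..v} \<times> {1..v}. layer d c B p q = 1}
        = {x \<in> {1..v} \<times> {1..v}. (case x of (p, q) \<Rightarrow> layer d c B p q) = 1}"
      by auto
    moreover have "card \<dots> = (\<Sum>(p, q)\<in>{1..v} \<times> {1..v}. layer d c B p q)"
    proof (rule card_Collect_eq_1)
      fix x assume "x \<in> {1..v} \<times> {1..v}"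
      then show "(case x of (p, q) \<Rightarrow> layer d c B p q) \<in> {0, 1}"
        by (cases x) (simp only: mem_Sigma_iff prod.case layer01[OF c])
    qed simp
    ultimately show ?thesis
      using K[OF c, of d] by (simp add: sum.cartesian_product case_prod_unfold)
  qed
  moreover have "int (\<Sum>p\<in>{1..v}. \<Sum>q\<in>{1..v}. layer d c B p q * layer d c' B p q) = L"
    if c: "c \<in> {1..v}" "c' \<in> {1..v}" "c \<noteq> c'" for d c c'
  proof -
    have "(\<Sum>p\<in>{1..v}. \<Sum>q\<in>{1..v}. T d c p q * T d c' p q)
        = (\<Sum>p\<in>{1..v}. \<Sum>q\<in>{1..v}. 1 - 2 * int (layer d c B p q) - 2 * int (layer d c' B p q)
            + 4 * int (layer d c B p q * layer d c' B p q))"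
      by (simp add: T_def algebra_simps)
    also have "\<dots> = int v * int v - 2 * K - 2 * K
        + 4 * int (\<Sum>p\<in>{1..v}. \<Sum>q\<in>{1..v}. layer d c B p q * layer d c' B p q)"
      using K c by (simp add: sum.distrib sum_subtractf sum_distrib_left [symmetric])
    finally show ?thesis
      using TT[OF c, of d] by simp
  qed
  ultimately show ?thesis
    using B01 unfolding C33_cube_def by blast
qed

text \<open>The Gram matrices of the rows and of the columns of \<open>s\<close> both have diagonal
  entries \<open>card I\<close> and all other entries \<open>m\<close>. The conditional form of
  \<open>row_prod\<close> and \<open>col_prod\<close> is the one that \<open>sum_mult_if_eq\<close>
  consumes.\<close>

locale sign_design =
  fixes I :: "'a set" and r m e :: int and s :: "'a \<Rightarrow> 'a \<Rightarrow> int"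
  assumes finite: "finite I"
    and square: "x \<in> I \<Longrightarrow> y \<in> I \<Longrightarrow> s x y * s x y = 1"
    and row_sum: "x \<in> I \<Longrightarrow> (\<Sum>y\<in>I. s x y) = r"
    and col_sum: "y \<in> I \<Longrightarrow> (\<Sum>x\<in>I. s x y) = r"
    and row_prod: "x \<in> I \<Longrightarrow> x' \<in> I \<Longrightarrow>
      (\<Sum>y\<in>I. s x y * s x' y) = (if x = x' then int (card I) else m)"
    and col_prod: "y \<in> I \<Longrightarrow> y' \<in> I \<Longrightarrow>
      (\<Sum>x\<in>I. s x y * s x y') = (if y = y' then int (card I) else m)"
    and diag: "x \<in> I \<Longrightarrow> s x x = e"
begin

text \<open>Sum the scalar products of row \<open>c\<close> with all rows in two ways. For the signs
  of a design this is \<open>k (k - 1) = l (v - 1)\<close>. The index \<open>c\<close> rules out an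
  empty \<open>I\<close>, for which \<open>r\<close> and \<open>m\<close> are arbitrary.\<close>

lemma row_sum_square:
  assumes "c \<in> I"
  shows "r * r = m * int (card I) + (int (card I) - m)"
proof -
  have "r * r = (\<Sum>y\<in>I. s c y * r)"
    using assms by (simp add: row_sum sum_distrib_right [symmetric])
  also have "\<dots> = (\<Sum>y\<in>I. s c y * (\<Sum>x\<in>I. s x y))"
    by (rule sum.cong) (simp_all add: col_sum)
  also have "\<dots> = (\<Sum>x\<in>I. \<Sum>y\<in>I. s x y * s c y)"
    by (subst sum.swap) (simp add: sum_distrib_left mult.commute)
  also have "\<dots> = (\<Sum>x\<in>I. 1 * (if x = c then int (card I) else m))"
    by (rule sum.cong) (use assms in \<open>simp_all add: row_prod\<close>)
  also have "\<dots> = m * int (card I) + (int (card I) - m)"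
    using assms by (subst sum_mult_if_eq [OF finite]) auto
  finally show ?thesis .
qed

definition cube :: "'a \<Rightarrow> 'a \<Rightarrow> 'a \<Rightarrow> int" where
  "cube x y z = s x y * s y z * s x z"

text \<open>The inner scalar product exceeds its generic value \<open>m\<close> by
  \<open>card I - m\<close> exactly when the outer index is \<open>c\<close>. There the outer weight
  is \<open>s c c\<close>, which is how the diagonal enters the result.\<close>

lemma sum_cube:
  assumes c: "c \<in> I"
  shows "(\<Sum>y\<in>I. \<Sum>z\<in>I. cube c y z) = m * r + (int (card I) - m) * e"
    and "(\<Sum>x\<in>I. \<Sum>z\<in>I. cube x c z) = m * r + (int (card I) - m) * e"
    and "(\<Sum>x\<in>I. \<Sum>y\<in>I. cube x y c) = m * r + (int (card I) - m) * e"
proof -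
  have "(\<Sum>y\<in>I. \<Sum>z\<in>I. cube c y z)
      = (\<Sum>y\<in>I. s c y * (\<Sum>z\<in>I. s y z * s c z))"
    by (simp add: cube_def sum_distrib_left mult_ac)
  also have "\<dots> = (\<Sum>y\<in>I. s c y * (if y = c then int (card I) else m))"
    by (rule sum.cong) (use c in \<open>simp_all add: row_prod\<close>)
  also have "\<dots> = m * r + (int (card I) - m) * e"
    using c by (subst sum_mult_if_eq [OF finite]) (auto simp: row_sum diag)
  finally show "(\<Sum>y\<in>I. \<Sum>z\<in>I. cube c y z) = m * r + (int (card I) - m) * e" .
  have "(\<Sum>x\<in>I. \<Sum>z\<in>I. cube x c z)
      = (\<Sum>x\<in>I. s x c * (\<Sum>z\<in>I. s x z * s c z))"
    by (simp add: cube_def sum_distrib_left mult_ac)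
  also have "\<dots> = (\<Sum>x\<in>I. s x c * (if x = c then int (card I) else m))"
    by (rule sum.cong) (use c in \<open>simp_all add: row_prod\<close>)
  also have "\<dots> = m * r + (int (card I) - m) * e"
    using c by (subst sum_mult_if_eq [OF finite]) (auto simp: col_sum diag)
  finally show "(\<Sum>x\<in>I. \<Sum>z\<in>I. cube x c z) = m * r + (int (card I) - m) * e" .
  \<comment> \<open>The swap makes \<open>x\<close> the inner index, so that columns
    \<open>y\<close> and \<open>c\<close> are paired. Summing over \<open>y\<close> first would pair
    row \<open>x\<close> with column \<open>c\<close>, about which the axioms say nothing.\<close>
  have "(\<Sum>x\<in>I. \<Sum>y\<in>I. cube x y c)
      = (\<Sum>y\<in>I. s y c * (\<Sum>x\<in>I. s x y * s x c))"
    by (subst sum.swap) (simp add: cube_def sum_distrib_left mult_ac)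
  also have "\<dots> = (\<Sum>y\<in>I. s y c * (if y = c then int (card I) else m))"
    by (rule sum.cong) (use c in \<open>simp_all add: col_prod\<close>)
  also have "\<dots> = m * r + (int (card I) - m) * e"
    using c by (subst sum_mult_if_eq [OF finite]) (auto simp: col_sum diag)
  finally show "(\<Sum>x\<in>I. \<Sum>y\<in>I. cube x y c) = m * r + (int (card I) - m) * e" .
qed

text \<open>Once the common square is gone, the double sum splits into two independent scalar
  products at the distinct indices \<open>c\<close> and \<open>c'\<close>: two of rows, one of
  columns and one of rows, or two of columns, according to the direction.\<close>

lemma sum_cube_mult_cube:
  assumes c: "c \<in> I" "c' \<in> I" "c \<noteq> c'"
  shows "(\<Sum>y\<in>I. \<Sum>z\<in>I. cube c y z * cube c' y z) = m * m"
    and "(\<Sum>x\<in>I. \<Sum>z\<in>I. cube x c z * cube x c' z) = m * m"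
    and "(\<Sum>x\<in>I. \<Sum>y\<in>I. cube x y c * cube x y c') = m * m"
proof -
  have "cube c y z * cube c' y z = (s c y * s c' y) * (s c z * s c' z) * (s y z * s y z)" for y z
    by (simp add: cube_def mult_ac)
  then have "(\<Sum>y\<in>I. \<Sum>z\<in>I. cube c y z * cube c' y z)
      = (\<Sum>y\<in>I. \<Sum>z\<in>I. (s c y * s c' y) * (s c z * s c' z))"
    by (intro sum.cong) (simp_all add: square)
  then show "(\<Sum>y\<in>I. \<Sum>z\<in>I. cube c y z * cube c' y z) = m * m"
    using c by (simp add: sum_product [symmetric] row_prod)
  have "cube x c z * cube x c' z = (s x c * s x c') * (s c z * s c' z) * (s x z * s x z)" for x z
    by (simp add: cube_def mult_ac)
  then have "(\<Sum>x\<in>I. \<Sum>z\<in>I. cube x c z * cube x c' z)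
      = (\<Sum>x\<in>I. \<Sum>z\<in>I. (s x c * s x c') * (s c z * s c' z))"
    by (intro sum.cong) (simp_all add: square)
  then show "(\<Sum>x\<in>I. \<Sum>z\<in>I. cube x c z * cube x c' z) = m * m"
    using c by (simp add: sum_product [symmetric] row_prod col_prod)
  have "cube x y c * cube x y c' = (s x c * s x c') * (s y c * s y c') * (s x y * s x y)" for x y
    by (simp add: cube_def mult_ac)
  then have "(\<Sum>x\<in>I. \<Sum>y\<in>I. cube x y c * cube x y c')
      = (\<Sum>x\<in>I. \<Sum>y\<in>I. (s x c * s x c') * (s y c * s y c'))"
    by (intro sum.cong) (simp_all add: square)
  then show "(\<Sum>x\<in>I. \<Sum>y\<in>I. cube x y c * cube x y c') = m * m"
    using c by (simp add: sum_product [symmetric] col_prod)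
qed

end

lemma sum_sign_mult_sign:
  fixes f g :: "'a \<Rightarrow> nat"
  assumes "(\<Sum>x\<in>I. f x) = k" "(\<Sum>x\<in>I. g x) = k" "(\<Sum>x\<in>I. f x * g x) = n"
  shows "(\<Sum>x\<in>I. (1 - 2 * int (f x)) * (1 - 2 * int (g x))) = int (card I) - 4 * int k + 4 * int n"
proof -
  have "(\<Sum>x\<in>I. (1 - 2 * int (f x)) * (1 - 2 * int (g x)))
      = (\<Sum>x\<in>I. 1 - 2 * int (f x) - 2 * int (g x) + 4 * int (f x * g x))"
    by (simp add: algebra_simps)
  also have "\<dots> = int (card I) - 2 * int (\<Sum>x\<in>I. f x) - 2 * int (\<Sum>x\<in>I. g x)
      + 4 * int (\<Sum>x\<in>I. f x * g x)"
    by (simp add: sum.distrib sum_subtractf sum_distrib_left [symmetric])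
  finally show ?thesis
    using assms by simp
qed

lemma sign_design_of_incidence:
  assumes "sym_design_incidence v k l A" "diagonal_const v i A"
  shows "sign_design {1..v} (int v - 2 * int k) (int v - 4 * int k + 4 * int l) (1 - 2 * int i)
    (\<lambda>x y. 1 - 2 * int (A x y))"
proof -
  have A01: "A x y \<in> {0, 1}" if "x \<in> {1..v}" "y \<in> {1..v}" for x y
    using assms that by (auto simp: sym_design_incidence_def)
  have row: "(\<Sum>y\<in>{1..v}. A x y) = k" if "x \<in> {1..v}" for x
    using assms that A01 card_Collect_eq_1[of "{1..v}" "A x"]
    by (simp add: sym_design_incidence_def)
  have col: "(\<Sum>x\<in>{1..v}. A x y) = k" if "y \<in> {1..v}" for y
    using assms that A01 card_Collect_eq_1[of "{1..v}" "\<lambda>x. A x y"]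
    by (simp add: sym_design_incidence_def)
  \<comment> \<open>A row of bits has scalar product \<open>k\<close> with itself, so
    \<open>sum_sign_mult_sign\<close> covers both cases: \<open>n = k\<close> gives
    \<open>v\<close>, and \<open>n = l\<close> gives the value for distinct lines.\<close>
  have idem: "A x y * A x y = A x y" if "x \<in> {1..v}" "y \<in> {1..v}" for x y
    using A01[OF that] by auto
  have row_prod: "(\<Sum>y\<in>{1..v}. A x y * A x' y) = (if x = x' then k else l)"
    if "x \<in> {1..v}" "x' \<in> {1..v}" for x x'
    using assms that row by (auto simp: sym_design_incidence_def idem)
  have col_prod: "(\<Sum>x\<in>{1..v}. A x y * A x y') = (if y = y' then k else l)"
    if "y \<in> {1..v}" "y' \<in> {1..v}" for y y'
    using assms that col by (auto simp: sym_design_incidence_def idem)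
  show ?thesis
  proof
    show "finite {1..v}"
      by simp
  next
    fix x y assume x: "x \<in> {1..v}" and y: "y \<in> {1..v}"
    show "(1 - 2 * int (A x y)) * (1 - 2 * int (A x y)) = 1"
      using A01[OF x y] by auto
    show "(\<Sum>z\<in>{1..v}. (1 - 2 * int (A x z)) * (1 - 2 * int (A y z)))
        = (if x = y then int (card {1..v}) else int v - 4 * int k + 4 * int l)"
      using sum_sign_mult_sign[OF row[OF x] row[OF y] row_prod[OF x y]] by simp
    show "(\<Sum>z\<in>{1..v}. (1 - 2 * int (A z x)) * (1 - 2 * int (A z y)))
        = (if x = y then int (card {1..v}) else int v - 4 * int k + 4 * int l)"
      using sum_sign_mult_sign[OF col[OF x] col[OF y] col_prod[OF x y]] by simp
  next
    fix x assume x: "x \<in> {1..v}"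
    show "(\<Sum>y\<in>{1..v}. 1 - 2 * int (A x y)) = int v - 2 * int k"
      unfolding row[OF x, symmetric] by (simp add: sum_subtractf sum_distrib_left)
    show "(\<Sum>y\<in>{1..v}. 1 - 2 * int (A y x)) = int v - 2 * int k"
      unfolding col[OF x, symmetric] by (simp add: sum_subtractf sum_distrib_left)
    show "1 - 2 * int (A x x) = 1 - 2 * int i"
      using assms(2) x by (simp add: diagonal_const_def)
  qed
qed

theorem theorem4p6:
  fixes i v k l :: nat
    and A :: "nat \<Rightarrow> nat \<Rightarrow> nat"
    and B :: "nat \<Rightarrow> nat \<Rightarrow> nat \<Rightarrow> nat"
  assumes "i \<in> {0, 1}"
    and "sym_design_incidence v k l A"
    and "diagonal_const v i A"
    and "\<forall>x\<in>{1..v}. \<forall>y\<in>{1..v}. \<forall>z\<in>{1..v}. B x y z = (A x y + A y z + A x z) mod 2"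
  shows "C33_cube v (K_param i (int v) (int k) (int l)) (Lambda_param i (int v) (int k) (int l)) B"
proof -
  define s where "s = (\<lambda>x y. 1 - 2 * int (A x y))"
  define m where "m = int v - 4 * int k + 4 * int l"
  interpret sign_design "{1..v}" "int v - 2 * int k" m "1 - 2 * int i" s
    unfolding s_def m_def using assms(2,3) by (rule sign_design_of_incidence)
  let ?K = "K_param i (int v) (int k) (int l)"
  let ?L = "Lambda_param i (int v) (int k) (int l)"
  have cube: "1 - 2 * int (B x y z) = cube x y z"
    if "x \<in> {1..v}" "y \<in> {1..v}" "z \<in> {1..v}" for x y z
  proof -
    have "1 - 2 * int (B x y z) = s x y * s y z * s x z"
      using that assms(2,4) sign_triple_mod_2[of "A x y" "A y z" "A x z"]
      by (simp add: s_def sym_design_incidence_def)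
    then show ?thesis
      by (simp only: cube_def)
  qed
  \<comment> \<open>The two sides differ by 4 times \<open>k (k - 1) - l (v - 1)\<close>, up to
    sign. That quantity need not vanish for \<open>v = 0\<close>, hence the index \<open>c\<close>;
    without layers there is nothing to show.\<close>
  have K: "m * (int v - 2 * int k) + (int v - m) * (1 - 2 * int i) = int v * int v - 2 * ?K"
    if "c \<in> {1..v}" for c
  proof -
    have "int k * int k = int k + int l * int v - int l"
      using row_sum_square[OF that] by (simp add: m_def algebra_simps)
    then show ?thesis
      using assms(1) by (auto simp: m_def K_param_def algebra_simps)
  qed
  \<comment> \<open>The sides differ by 8 times the same quantity, up to sign. The left side does
    not involve \<open>i\<close>; the dependence of \<open>?L\<close> on \<open>i\<close>
    compensates that of \<open>?K\<close>.\<close>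
  have L: "m * m = int v * int v - 4 * ?K + 4 * ?L" if "c \<in> {1..v}" for c
  proof -
    have "int k * int k = int k + int l * int v - int l"
      using row_sum_square[OF that] by (simp add: m_def algebra_simps)
    then show ?thesis
      using assms(1) by (auto simp: m_def K_param_def Lambda_param_def algebra_simps)
  qed
  show ?thesis
  proof (rule C33_cube_signedI)
    fix x y z assume "x \<in> {1..v}" "y \<in> {1..v}" "z \<in> {1..v}"
    then show "B x y z \<in> {0, 1}"
      using assms(4) by auto
  next
    fix d c assume c: "c \<in> {1..v}"
    show "(\<Sum>p\<in>{1..v}. \<Sum>q\<in>{1..v}. 1 - 2 * int (layer d c B p q)) = int v * int v - 2 * ?K"
      using sum_cube[OF c] K[OF c] c by (cases d) (simp_all add: cube)
  next
    fix d c c' assume c: "c \<in> {1..v}" "c' \<in> {1..v}" "c \<noteq> c'"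
    show "(\<Sum>p\<in>{1..v}. \<Sum>q\<in>{1..v}. (1 - 2 * int (layer d c B p q)) * (1 - 2 * int (layer d c' B p q)))
        = int v * int v - 4 * ?K + 4 * ?L"
      using sum_cube_mult_cube[OF c] L[OF c(1)] c by (cases d) (simp_all add: cube)
  qed
qed

end
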